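(* Let $n\equiv 5\pmod 6$ be a positive integer and $H$ an abelian group of order $n^2+n+1$. Suppose $T_0,T_1\subseteq H$ are inverse-closed subsets with $e\in T_0$ and $k_0+k_1=2n+1$ such that $T_0T_1=H-e$ and $T_0^2+T_1^2=2H-T_0^{(2)}-T_1^{(2)}+2ne$ in $\mathbb{Z}[H]$. Then, with $\ell_0=|T_1\cap T_0^{(3)}|$ and $u=|T_0\cap T_1^{(3)}|+|T_1\cap T_1^{(3)}|$, $$|X_0|\le\frac{n-2\ell_0+1-\theta_0}{3},\qquad \sum_{i\ge5}\frac{s_i}{3}|X_i|\le\frac{n-2\ell_0+1-\theta_0}{3},$$ $$\frac{2n^2-4n+7\ell_0+3+2\theta_0}{3}\le|X_1|\le\frac{2n^2-\ell_0+7-2\theta_0}{3},$$ $$\frac{n^2-6n+7\ell_0-1+2\theta_0}{3}\le|X_4|\le\frac{n^2-3n+\ell_0+2-\theta_0}{3},$$ $$|Y_0|\le\frac{n-2u+2-\theta_1}{3},\qquad\sum_{i\ge5}\frac{s_i}{3}|Y_i|\le\frac{n-2u+2-\theta_1}{3},$$ $$\frac{2n^2-6n+7u-4+2\theta_1}{3}\le|Y_1|\le\frac{2n^2-2n-u+4-2\theta_1}{3},$$ $$\frac{n^2-4n+7u-7+2\theta_1}{3}\le|Y_4|\le\frac{n^2-n+u-1-\theta_1}{3}.$$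
   Context: $H$ is written multiplicatively with identity $e$. $\mathbb{Z}[H]$ is the integral group ring; a (multi)subset $D$ of $H$ is identified with $\sum_{g\in D}g$, and $H$ also denotes $\sum_{h\in H}h$. For $A=\sum a_gg$ and $t\in\mathbb{Z}$, $A^{(t)}=\sum a_gg^t$. Inverse-closed means $T^{(-1)}=T$. $k_0=|T_0|$, $k_1=|T_1|$, $\hat T=T_0+T_1$. Intersections and set differences involving group ring elements with nonnegative coefficients refer to their supports. $X_i$ (resp. $Y_i$) is the set of elements of $H$ whose coefficient in $\hat T^{(2)}T_0$ (resp. $\hat T^{(2)}T_1$) is exactly $i$. $\theta_0=|(T_0^2\setminus T_0^{(2)})\cap\hat T^{(4)}|$ and $\theta_1=\frac{|T_1\cap\hat T^{(2)}|}{2}+|(T_1^2\setminus(T_1^{(2)}\cup\{e\}))\cap\hat T^{(4)}|$. For $i\ge5$, $s_i=\frac{(i-1)(i-4)}{2}$ if $i\equiv1\pmod3$ and $s_i=\frac{(i-2)(i-3)}{2}$ otherwise. *)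

theory Defs
  imports Complex_Main "HOL-Library.Poly_Mapping" "HOL-Number_Theory.Cong"
begin

text \<open>
  The abelian group \<open>H\<close> is a type of class \<open>ab_group_add\<close>, so its operation is written additively:
  the identity \<open>e\<close> is \<open>0\<close> and the power \<open>g\<^sup>t\<close> is the multiple \<open>zmul t g\<close>.  The integral group ring
  \<open>\<int>[H]\<close> is the type \<open>'a \<Rightarrow>\<^sub>0 int\<close> of finitely supported functions, whose library multiplication
  is convolution.  In it, the group element \<open>g\<close> is \<open>Poly_Mapping.single g 1\<close>, \<open>e\<close> is \<open>1\<close>, the
  coefficient of \<open>g\<close> in \<open>A\<close> is \<open>gr_coeff A g\<close>, and the support of \<open>A\<close> is \<open>gr_supp A\<close>.
\<close>

abbreviation gr_coeff :: "('a \<Rightarrow>\<^sub>0 int) \<Rightarrow> 'a \<Rightarrow> int" where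
  "gr_coeff \<equiv> Poly_Mapping.lookup"

abbreviation gr_supp :: "('a \<Rightarrow>\<^sub>0 int) \<Rightarrow> 'a set" where
  "gr_supp \<equiv> Poly_Mapping.keys"

definition zmul :: "int \<Rightarrow> 'a::group_add \<Rightarrow> 'a" where
  "zmul t g = (if 0 \<le> t then ((+) g ^^ nat t) 0 else - (((+) g ^^ nat (- t)) 0))"

text \<open>Meaningful only for finite \<open>D\<close>; in a finite group \<open>gr UNIV\<close> is the element written \<open>H\<close>.\<close>

definition gr :: "'a set \<Rightarrow> 'a \<Rightarrow>\<^sub>0 int" where
  "gr D = (\<Sum>g\<in>D. Poly_Mapping.single g 1)"

definition power_map :: "('a::group_add \<Rightarrow>\<^sub>0 int) \<Rightarrow> int \<Rightarrow> 'a \<Rightarrow>\<^sub>0 int"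
    ("_\<^bsup>'(_')\<^esup>" [1000, 0] 1000) where
  "A\<^bsup>(t)\<^esup> = (\<Sum>g\<in>gr_supp A. Poly_Mapping.single (zmul t g) (gr_coeff A g))"

definition inverse_closed :: "'a::group_add set \<Rightarrow> bool" where
  "inverse_closed T \<longleftrightarrow> (gr T)\<^bsup>(-1)\<^esup> = gr T"

definition That :: "'a set \<Rightarrow> 'a set \<Rightarrow> 'a \<Rightarrow>\<^sub>0 int" where
  "That T0 T1 = gr T0 + gr T1"

definition X_set :: "'a::ab_group_add set \<Rightarrow> 'a set \<Rightarrow> nat \<Rightarrow> 'a set" where
  "X_set T0 T1 i = {h. gr_coeff ((That T0 T1)\<^bsup>(2)\<^esup> * gr T0) h = int i}"

definition Y_set :: "'a::ab_group_add set \<Rightarrow> 'a set \<Rightarrow> nat \<Rightarrow> 'a set" where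
  "Y_set T0 T1 i = {h. gr_coeff ((That T0 T1)\<^bsup>(2)\<^esup> * gr T1) h = int i}"

definition theta0 :: "'a::ab_group_add set \<Rightarrow> 'a set \<Rightarrow> real" where
  "theta0 T0 T1 =
     real (card ((gr_supp ((gr T0)\<^sup>2) - gr_supp ((gr T0)\<^bsup>(2)\<^esup>)) \<inter> gr_supp ((That T0 T1)\<^bsup>(4)\<^esup>)))"

definition theta1 :: "'a::ab_group_add set \<Rightarrow> 'a set \<Rightarrow> real" where
  "theta1 T0 T1 =
     real (card (T1 \<inter> gr_supp ((That T0 T1)\<^bsup>(2)\<^esup>))) / 2
     + real (card ((gr_supp ((gr T1)\<^sup>2) - (gr_supp ((gr T1)\<^bsup>(2)\<^esup>) \<union> {0})) \<inter> gr_supp ((That T0 T1)\<^bsup>(4)\<^esup>)))"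

definition s_wt :: "nat \<Rightarrow> real" where
  "s_wt i = (if [i = 1] (mod 3) then (real i - 1) * (real i - 4) / 2
          else (real i - 2) * (real i - 3) / 2)"

text \<open>
  The sum of \<open>s\<^sub>i |Z\<^sub>i| / 3\<close> over all \<open>i \<ge> 5\<close>.  It is restricted to the indices with \<open>Z\<^sub>i \<noteq> {}\<close>
  because \<open>sum\<close> needs a finite index set; for the disjoint families \<open>X_set T0 T1\<close> and \<open>Y_set T0 T1\<close> in a finite group
  only finitely many indices remain, and the omitted terms vanish.
\<close>

definition s_sum :: "(nat \<Rightarrow> 'a set) \<Rightarrow> real" where
  "s_sum Z = (\<Sum>i | 5 \<le> i \<and> Z i \<noteq> {}. s_wt i / 3 * real (card (Z i)))"

end

theory Submission
  imports Defs
begin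

text \<open>
  Write \<open>T = T0 + T1\<close>, let \<open>(S, R)\<close> be \<open>(T0, T1)\<close> or \<open>(T1, T0)\<close>, and let \<open>d h\<close> be the coefficient of \<open>h\<close> in
  \<open>T^(2) S\<close>.  The two group ring equations turn \<open>T^(2) S\<close> into a combination of \<open>H\<close>, \<open>S\<close>, \<open>R\<close> and \<open>S\<^sup>3\<close>;
  since \<open>S\<^sup>3\<close> is congruent to \<open>S^(3)\<close> modulo 3, all residues \<open>d h mod 3\<close> are known.  Squaring \<open>T\<close> and applying
  \<open>g \<mapsto> g\<^sup>2\<close> gives \<open>(T^(2))\<^sup>2 = 4 H - T^(4) + (2 n - 2) e\<close>, hence \<open>\<Sum> (d h)\<^sup>2\<close>, the coefficient of \<open>e\<close> in
  \<open>(T^(2) S)\<^sup>2\<close>; the coefficients of \<open>S\<^sup>2\<close> on \<open>T^(4)\<close> that enter are determined by their parity and the bound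
  from the second equation.  So the sum of \<open>(d - 2) (d - 3) / 2\<close> over \<open>d \<noteq> 1 mod 3\<close> plus that of
  \<open>(d - 1) (d - 4) / 2\<close> over \<open>d = 1 mod 3\<close> is explicit.  All its terms are nonnegative, and they vanish for
  \<open>d \<in> {1, 2, 3, 4}\<close>, so it controls every deviation from these values.
\<close>

section \<open>Power maps on the group ring of a finite abelian group\<close>

lemma zmul_simps:
  "zmul (- 1) g = - g" "zmul 2 g = g + g" "zmul 3 g = g + g + g" "zmul 4 g = g + g + g + g"
  "zmul (- 2) g = - (g + g)"
  by (simp_all add: zmul_def eval_nat_numeral add.assoc)

lemma zmul_add: "zmul t (g + h) = zmul t g + zmul t (h :: 'a :: ab_group_add)"
proof -
  have "((+) (g + h) ^^ k) 0 = ((+) g ^^ k) 0 + ((+) h ^^ k) 0" for k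
    by (induction k) (simp_all add: algebra_simps)
  then show ?thesis by (simp add: zmul_def)
qed

text \<open>Translation by \<open>g\<close> permutes the group, so adding \<open>g\<close> to every
  element leaves the sum of all elements unchanged.\<close>

lemma funpow_card_UNIV:
  fixes g :: "'a :: ab_group_add"
  assumes "finite (UNIV :: 'a set)"
  shows "((+) g ^^ card (UNIV :: 'a set)) 0 = 0"
proof -
  have "(\<Sum>h\<in>A. g) = ((+) g ^^ card A) 0" if "finite A" for A :: "'a set"
    using that by induction auto
  then have "((+) g ^^ card (UNIV :: 'a set)) 0 = (\<Sum>h\<in>(UNIV :: 'a set). g)" using assms by simp
  also have "\<dots> = (\<Sum>h\<in>UNIV. h + g) - (\<Sum>h\<in>UNIV. h)" by (simp add: sum.distrib)
  also have "(\<Sum>h\<in>UNIV. h + g) = (\<Sum>h\<in>UNIV. h)"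
    by (rule sum.reindex_bij_witness[of _ "\<lambda>h. h - g" "\<lambda>h. h + g"]) auto
  finally show ?thesis by simp
qed

text \<open>If \<open>p\<close> kills \<open>g - h\<close>, then so does \<open>p * k\<close>; the
  group order \<open>p * k + 1\<close> also kills it, so \<open>g - h\<close> is 0.\<close>

lemma inj_zmul:
  assumes fin: "finite (UNIV :: 'a :: ab_group_add set)" and "card (UNIV :: 'a set) = p * k + 1"
  shows "inj (zmul (int p) :: 'a \<Rightarrow> 'a)"
proof (rule injI)
  fix g h :: 'a assume "zmul (int p) g = zmul (int p) h"
  moreover have "zmul (int p) g = zmul (int p) (g - h) + zmul (int p) h"
    by (simp flip: zmul_add)
  ultimately have "((+) (g - h) ^^ p) 0 = 0" by (simp add: zmul_def)
  then have "((((+) (g - h)) ^^ p) ^^ k) 0 = 0" by (induction k) auto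
  then have "((+) (g - h) ^^ (p * k)) 0 = 0" by (simp add: funpow_mult)
  then have "((+) (g - h) ^^ card (UNIV :: 'a set)) 0 = g - h" using assms(2) by simp
  then show "g = h" using funpow_card_UNIV[OF fin] by simp
qed

lemma gr_coeff_gr: "finite D \<Longrightarrow> gr_coeff (gr D) h = of_bool (h \<in> D)"
  by (simp add: gr_def lookup_sum lookup_single when_def of_bool_def sum.delta)

lemma gr_supp_gr: "finite D \<Longrightarrow> gr_supp (gr D) = D"
  by (auto simp: in_keys_iff gr_coeff_gr)

lemma gr_Un: "finite C \<Longrightarrow> finite D \<Longrightarrow> C \<inter> D = {} \<Longrightarrow> gr (C \<union> D) = gr C + gr D"
  by (simp add: gr_def sum.union_disjoint)

lemma power_map_UNIV:
  assumes "finite (UNIV :: 'a :: group_add set)"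
  shows "A\<^bsup>(t)\<^esup> = (\<Sum>g\<in>(UNIV :: 'a set). Poly_Mapping.single (zmul t g) (gr_coeff A g))"
  unfolding power_map_def
  by (rule sum.mono_neutral_left) (use assms in \<open>auto simp: in_keys_iff\<close>)

lemma power_map_single:
  "(Poly_Mapping.single g c)\<^bsup>(t)\<^esup> = Poly_Mapping.single (zmul t g) c"
  by (cases "c = 0") (simp_all add: power_map_def)

lemma power_map_add:
  assumes "finite (UNIV :: 'a :: group_add set)"
  shows "(A + B :: 'a \<Rightarrow>\<^sub>0 int)\<^bsup>(t)\<^esup> = A\<^bsup>(t)\<^esup> + B\<^bsup>(t)\<^esup>"
  by (simp add: power_map_UNIV[OF assms] lookup_add single_add sum.distrib)

lemma power_map_uminus:
  assumes "finite (UNIV :: 'a :: group_add set)"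
  shows "(- A :: 'a \<Rightarrow>\<^sub>0 int)\<^bsup>(t)\<^esup> = - A\<^bsup>(t)\<^esup>"
  by (simp add: power_map_UNIV[OF assms] single_uminus sum_negf)

lemma power_map_sum:
  assumes "finite (UNIV :: 'a :: group_add set)"
  shows "(sum F I :: 'a \<Rightarrow>\<^sub>0 int)\<^bsup>(t)\<^esup> = (\<Sum>i\<in>I. (F i)\<^bsup>(t)\<^esup>)"
proof (induction I rule: infinite_finite_induct)
qed (simp_all add: power_map_add[OF assms], simp_all add: power_map_def)

lemma sum_single:
  assumes "finite (UNIV :: 'a set)"
  shows "(\<Sum>g\<in>UNIV. Poly_Mapping.single g (gr_coeff A g)) = (A :: 'a \<Rightarrow>\<^sub>0 int)"
  by (rule poly_mapping_eqI)
     (use assms in \<open>simp add: lookup_sum lookup_single when_def sum.delta\<close>)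

text \<open>As the group is abelian, \<open>zmul t\<close> is an endomorphism of it; expanding both
  factors into group elements extends this to the group ring.\<close>

lemma power_map_mult:
  assumes fin: "finite (UNIV :: 'a :: ab_group_add set)"
  shows "(A * B :: 'a \<Rightarrow>\<^sub>0 int)\<^bsup>(t)\<^esup> = A\<^bsup>(t)\<^esup> * B\<^bsup>(t)\<^esup>"
proof -
  have "(A * B)\<^bsup>(t)\<^esup> = ((\<Sum>g\<in>UNIV. Poly_Mapping.single g (gr_coeff A g))
      * (\<Sum>h\<in>UNIV. Poly_Mapping.single h (gr_coeff B h)))\<^bsup>(t)\<^esup>"
    by (simp add: sum_single[OF fin])
  also have "\<dots> = A\<^bsup>(t)\<^esup> * B\<^bsup>(t)\<^esup>"
    by (simp add: sum_product mult_single power_map_sum[OF fin] power_map_single zmul_add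
        power_map_UNIV[OF fin, of A] power_map_UNIV[OF fin, of B])
  finally show ?thesis .
qed

lemma power_map_power_map:
  assumes fin: "finite (UNIV :: 'a :: group_add set)"
    and "\<And>g :: 'a. zmul t (zmul s g) = zmul r g"
  shows "(A\<^bsup>(s)\<^esup>)\<^bsup>(t)\<^esup> = (A\<^bsup>(r)\<^esup> :: 'a \<Rightarrow>\<^sub>0 int)"
  by (simp add: power_map_UNIV[OF fin, of A] power_map_sum[OF fin] power_map_single assms(2))

lemma power_map_gr:
  assumes fin: "finite (UNIV :: 'a :: group_add set)" and "inj_on (zmul t) D"
  shows "(gr D)\<^bsup>(t)\<^esup> = gr (zmul t ` D :: 'a set)"
  using assms by (simp add: gr_def power_map_sum[OF fin] power_map_single sum.reindex)

lemma gr_coeff_power_map_uminus: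
  assumes fin: "finite (UNIV :: 'a :: group_add set)"
  shows "gr_coeff (A\<^bsup>(-1)\<^esup>) h = gr_coeff A (- h :: 'a)"
proof -
  have "- g = h \<longleftrightarrow> g = - h" for g :: 'a by auto
  then show ?thesis using fin
    by (simp add: power_map_UNIV[OF fin] zmul_simps lookup_sum lookup_single when_def sum.delta)
qed

lemma gr_coeff_mult:
  fixes A B :: "'a :: ab_group_add \<Rightarrow>\<^sub>0 int"
  assumes fin: "finite (UNIV :: 'a set)"
  shows "gr_coeff (A * B) h = (\<Sum>g\<in>UNIV. gr_coeff A g * gr_coeff B (h - g))"
proof -
  have "A * B = (\<Sum>g\<in>UNIV. \<Sum>g'\<in>UNIV. Poly_Mapping.single (g + g') (gr_coeff A g * gr_coeff B g'))"
    using arg_cong2[OF sum_single[OF fin, of A] sum_single[OF fin, of B], of "(*)"]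
    by (simp add: sum_product mult_single)
  moreover have "g + g' = h \<longleftrightarrow> g' = h - g" for g g' :: 'a by (auto simp: algebra_simps)
  ultimately show ?thesis using fin
    by (simp add: lookup_sum lookup_single when_def sum.delta)
qed

lemma gr_coeff_of_int_mult:
  "gr_coeff (of_int c * A) h = c * gr_coeff (A :: 'a :: ab_group_add \<Rightarrow>\<^sub>0 int) h"
proof -
  have nat: "gr_coeff (of_nat m * A) h = int m * gr_coeff A h" for m
    by (induction m) (simp_all add: lookup_add algebra_simps)
  show ?thesis
    by (cases c rule: int_cases2) (simp_all add: nat)
qed

text \<open>On a single group element the ring power and the power map agree exactly, so induction
  over \<open>D\<close> only accumulates multiples of \<open>p\<close>. The binomial congruence is a
  hypothesis because for exponents 2 and 3 an explicit \<open>C\<close> can be given.\<close>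

lemma frobenius:
  fixes D :: "'a :: ab_group_add set"
  assumes "finite D" and fin: "finite (UNIV :: 'a set)" and binom: "\<And>A B :: 'a \<Rightarrow>\<^sub>0 int. \<exists>C. (A + B) ^ p = A ^ p + B ^ p + of_nat p * C"
    and "0 < p"
  shows "\<exists>C. gr D ^ p = (gr D)\<^bsup>(int p)\<^esup> + of_nat p * C"
  using assms(1)
proof (induction D rule: finite_induct)
  case empty
  then show ?case using \<open>0 < p\<close> by (intro exI[of _ 0]) (simp add: gr_def power_map_def power_0_left)
next
  case (insert g D)
  let ?g = "Poly_Mapping.single g 1 :: 'a \<Rightarrow>\<^sub>0 int"
  have "?g ^ k = Poly_Mapping.single (((+) g ^^ k) 0) 1" for k
    by (induction k) (simp_all add: mult_single flip: single_one)
  then have "?g ^ p = ?g\<^bsup>(int p)\<^esup>" by (simp add: power_map_single zmul_def)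
  moreover obtain C C' where "gr D ^ p = (gr D)\<^bsup>(int p)\<^esup> + of_nat p * C"
    and "(?g + gr D) ^ p = ?g ^ p + gr D ^ p + of_nat p * C'"
    using insert.IH binom by blast
  moreover have "gr (insert g D) = ?g + gr D" using insert by (simp add: gr_def)
  ultimately show ?case using fin
    by (intro exI[of _ "C + C'"]) (simp add: power_map_add algebra_simps)
qed

section \<open>Augmentation: the homomorphism sending every group element to 1\<close>

definition aug :: "('a \<Rightarrow>\<^sub>0 int) \<Rightarrow> int" where
  "aug A = (\<Sum>g\<in>UNIV. gr_coeff A g)"

lemma aug_gr: "finite (UNIV :: 'a set) \<Longrightarrow> aug (gr D) = int (card (D :: 'a set))"
  by (simp add: aug_def gr_coeff_gr finite_subset[OF subset_UNIV])

lemma mult_gr_UNIV: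
  fixes A :: "'a :: ab_group_add \<Rightarrow>\<^sub>0 int"
  assumes fin: "finite (UNIV :: 'a set)"
  shows "A * gr UNIV = of_int (aug A) * gr UNIV"
proof (rule poly_mapping_eqI)
  fix h
  show "gr_coeff (A * gr UNIV) h = gr_coeff (of_int (aug A) * gr UNIV) h"
    unfolding gr_coeff_of_int_mult by (simp add: gr_coeff_mult[OF fin] gr_coeff_gr[OF fin] aug_def)
qed

text \<open>Multiplication by H reads off the augmentation, so evaluating A B H in two ways and
  comparing one coefficient suffices.\<close>

lemma aug_mult:
  fixes A B :: "'a :: ab_group_add \<Rightarrow>\<^sub>0 int"
  assumes fin: "finite (UNIV :: 'a set)"
  shows "aug (A * B) = aug A * aug B"
proof -
  have "of_int (aug (A * B)) * gr UNIV = of_int (aug A * aug B) * (gr UNIV :: 'a \<Rightarrow>\<^sub>0 int)"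
    unfolding mult_gr_UNIV[OF fin, symmetric] of_int_mult
    by (simp only: mult.assoc mult_gr_UNIV[OF fin, of B] mult.left_commute[of A])
      (simp only: mult_gr_UNIV[OF fin, of A] mult_ac)
  then have "gr_coeff (of_int (aug (A * B)) * gr UNIV) (0 :: 'a) = gr_coeff (of_int (aug A * aug B) * gr UNIV) (0 :: 'a)"
    by (rule arg_cong[of _ _ "\<lambda>A. gr_coeff A (0 :: 'a)"])
  then show ?thesis by (simp only: gr_coeff_of_int_mult gr_coeff_gr[OF fin]) simp
qed

lemma zmul_zero [simp]: "zmul t (0 :: 'a :: ab_group_add) = 0"
  using zmul_add[of t 0 0] by simp

lemma power_map_of_int:
  "(of_int c :: 'a :: ab_group_add \<Rightarrow>\<^sub>0 int)\<^bsup>(t)\<^esup> = of_int c"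
proof -
  have "Poly_Mapping.single (0 :: 'a) c = of_int c"
    using single_of_int[of c, where 'b = int and 'a = 'a] by (simp only: of_int_eq_id id_apply)
  then show ?thesis using power_map_single[of "0 :: 'a" c t] by simp
qed

text \<open>Here \<open>a\<close>, \<open>b\<close>, \<open>h\<close>, \<open>s\<close>,
  \<open>r\<close>, \<open>N\<close> stand for S, R, H, S^(2), R^(2), 2n e, and \<open>x\<close>,
  \<open>y\<close> for |S|, |R|; the left side is T^(2) S. The product relation turns the mixed term
  \<open>b * (a * b)\<close> into \<open>b * h - b\<close>, so only the pure cube survives.\<close>

lemma sum_mult_eq:
  fixes a b h r s N x y :: "'r :: comm_ring_1"
  assumes ab: "a * b = h - 1" and sq: "a\<^sup>2 + b\<^sup>2 = 2 * h - s - r + N"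
    and ah: "a * h = x * h" and bh: "b * h = y * h"
  shows "(s + r) * a = (2 * x - y) * h + N * a + b - a ^ 3"
proof -
  have "s + r = 2 * h + N - (a\<^sup>2 + b\<^sup>2)" unfolding sq by simp
  then have "(s + r) * a = (2 * h + N - (a\<^sup>2 + b\<^sup>2)) * a" by simp
  also have "\<dots> = 2 * (a * h) + N * a - a ^ 3 - b * (a * b)"
    by (simp add: algebra_simps power2_eq_square power3_eq_cube)
  also have "b * (a * b) = b * h - b" unfolding ab by (simp add: right_diff_distrib)
  also have "2 * (a * h) + N * a - a ^ 3 - (b * h - b) = (2 * x - y) * h + N * a + b - a ^ 3"
    unfolding ah bh by (simp add: algebra_simps)
  finally show ?thesis .
qed

text \<open>In the same notation this is T^2. The unary minus lets \<open>power_map_add\<close> and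
  \<open>power_map_uminus\<close> distribute a power map over the right side.\<close>

lemma add_square_eq:
  fixes a b h r s N :: "'r :: comm_ring_1"
  assumes ab: "a * b = h - 1" and sq: "a\<^sup>2 + b\<^sup>2 = 2 * h - s - r + N"
  shows "(a + b) * (a + b) = 4 * h + - (s + r) + (N - 2)"
proof -
  have "(a + b) * (a + b) = (a\<^sup>2 + b\<^sup>2) + 2 * (a * b)" by (simp add: algebra_simps power2_eq_square)
  also have "\<dots> = 4 * h + - (s + r) + (N - 2)" unfolding ab sq by (simp add: algebra_simps)
  finally show ?thesis .
qed

section \<open>Level sets of a function with known residues modulo 3\<close>

text \<open>
  \<open>W\<close> is the controlled sum, \<open>P\<close> the number of \<open>h\<close> with residue 1, and \<open>B\<close> the excess of \<open>\<Sum> d\<close> over the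
  value it would have if \<open>d\<close> took only the values 1, 2 and 3.
\<close>

lemma level_set_bounds:
  fixes d :: "'a \<Rightarrow> nat" and W B P :: real
  assumes fin: "finite (UNIV :: 'a set)"
    and W: "W = (\<Sum>h\<in>UNIV. (real (d h) - 1) * (real (d h) - 4) / 2)
               + real (card {h. d h mod 3 = 0}) + real (card {h. d h mod 3 = 2})"
    and B: "B = (\<Sum>h\<in>UNIV. real (d h)) - real (card (UNIV :: 'a set))
               - 2 * real (card {h. d h mod 3 = 0}) - real (card {h. d h mod 3 = 2})"
    and P: "P = real (card (UNIV :: 'a set)) - real (card {h. d h mod 3 = 0}) - real (card {h. d h mod 3 = 2})"
  shows "3 * real (card {h. d h = 0}) \<le> W"
    and "3 * s_sum (\<lambda>i. {h. d h = i}) \<le> W"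
    and "3 * P - B - 2 * W \<le> 3 * real (card {h. d h = 1})"
    and "3 * real (card {h. d h = 1}) \<le> 3 * P - B + 2 * W"
    and "B - 2 * W \<le> 3 * real (card {h. d h = 4})"
    and "3 * real (card {h. d h = 4}) \<le> B + W"
proof -
  \<comment> \<open>\<open>w i\<close>, \<open>b i\<close>, \<open>p i\<close> are what one element
    with value \<open>i\<close> contributes to \<open>W\<close>, \<open>B\<close>, \<open>P\<close>,
    so every bound reduces to an inequality in \<open>i\<close>.\<close>
  define w :: "nat \<Rightarrow> real" where
    "w i = (real i - 1) * (real i - 4) / 2 + of_bool (i mod 3 = 0) + of_bool (i mod 3 = 2)" for i
  define b :: "nat \<Rightarrow> real" where
    "b i = real i - 1 - 2 * of_bool (i mod 3 = 0) - of_bool (i mod 3 = 2)" for i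
  define p :: "nat \<Rightarrow> real" where
    "p i = 1 - of_bool (i mod 3 = 0) - of_bool (i mod 3 = 2)" for i
  have card_eq: "real (card {h. Q h}) = (\<Sum>h\<in>UNIV. of_bool (Q h))" for Q :: "'a \<Rightarrow> bool"
    using fin by simp
  have W': "W = (\<Sum>h\<in>UNIV. w (d h))"
    unfolding W card_eq w_def by (simp add: sum.distrib)
  have B': "B = (\<Sum>h\<in>UNIV. b (d h))"
    unfolding B card_eq b_def by (simp add: sum.distrib sum_subtractf sum_distrib_left)
  have P': "P = (\<Sum>h\<in>UNIV. p (d h))"
    unfolding P card_eq p_def by (simp add: sum.distrib sum_subtractf)
  \<comment> \<open>For residues 0 and 2 the added 1 turns (i-1)(i-4)/2 into (i-2)(i-3)/2.\<close>
  have w5: "w i = s_wt i" if "5 \<le> i" for i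
  proof -
    consider "i mod 3 = 0" | "i mod 3 = 1" | "i mod 3 = 2" by linarith
    then show ?thesis
      by cases (simp_all add: w_def s_wt_def cong_def field_simps)
  qed
  have big: "0 \<le> b i" "b i \<le> 2 * w i" "3 * p i \<le> b i + 2 * w i" "0 \<le> w i" "0 \<le> p i" if "5 \<le> i" for i
  proof -
    have i: "5 \<le> real i" using that by simp
    \<comment> \<open>This replaces the quadratic term by a linear lower bound, after which only
      linear arithmetic is left.\<close>
    have "0 \<le> (real i - 5) * (real i - 1)" using i by simp
    then have q: "real i - 1 \<le> (real i - 1) * (real i - 4)" by (simp add: algebra_simps)
    define X and e0 e2 :: real where "X = (real i - 1) * (real i - 4)"
      and "e0 = of_bool (i mod 3 = 0)" and "e2 = of_bool (i mod 3 = 2)"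
    then have "0 \<le> e0" "0 \<le> e2" "e0 + e2 \<le> 1" and "w i = X / 2 + e0 + e2"
      and "b i = real i - 1 - 2 * e0 - e2" and "p i = 1 - e0 - e2"
      by (simp_all add: w_def b_def p_def)
    with i q[folded X_def] show "0 \<le> b i" "b i \<le> 2 * w i" "3 * p i \<le> b i + 2 * w i" "0 \<le> w i" "0 \<le> p i"
      by linarith+
  qed
  \<comment> \<open>Among 0, ..., 4 only 0 has positive weight \<open>w\<close>, and only 0 and 4
    have nonzero \<open>b\<close>, with values -3 and 3: this isolates level 4, up to an error that
    \<open>w\<close> pays for.\<close>
  have small: "b 0 = - 3" "b (Suc 0) = 0" "b 2 = 0" "b 3 = 0" "b 4 = 3" "w 0 = 3" "w (Suc 0) = 0" "w 2 = 0"
      "w 3 = 0" "w 4 = 0" "p 0 = 0" "p (Suc 0) = 1" "p 2 = 0" "p 3 = 0" "p 4 = 1"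
    by (simp_all add: b_def w_def p_def)
  have small_or_big: "i \<in> {0, 1, 2, 3, 4} \<or> 5 \<le> i" for i :: nat by auto
  have w_nonneg: "0 \<le> w i" for i
    using small_or_big[of i] big[of i] by (auto simp: small)
  show "3 * real (card {h. d h = 0}) \<le> W"
    unfolding card_eq W' sum_distrib_left
  proof (rule sum_mono)
    fix h show "3 * of_bool (d h = 0) \<le> w (d h)"
      using w_nonneg[of "d h"] small by (cases "d h = 0") auto
  qed
  have pw: "3 * p i - b i - 2 * w i \<le> 3 * of_bool (i = 1)" "3 * of_bool (i = 1) \<le> 3 * p i - b i + 2 * w i"
      "b i - 2 * w i \<le> 3 * of_bool (i = 4)" "3 * of_bool (i = 4) \<le> b i + w i" for i
    using small_or_big[of i] big[of i] by (auto simp: small)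
  show "3 * P - B - 2 * W \<le> 3 * real (card {h. d h = 1})"
    unfolding card_eq W' B' P' sum_distrib_left sum_subtractf[symmetric]
    by (intro sum_mono pw)
  show "3 * real (card {h. d h = 1}) \<le> 3 * P - B + 2 * W"
    unfolding card_eq W' B' P' sum_distrib_left sum_subtractf[symmetric] sum.distrib[symmetric]
    by (intro sum_mono pw)
  show "B - 2 * W \<le> 3 * real (card {h. d h = 4})"
    unfolding card_eq W' B' P' sum_distrib_left sum_subtractf[symmetric]
    by (intro sum_mono pw)
  show "3 * real (card {h. d h = 4}) \<le> B + W"
    unfolding card_eq W' B' P' sum_distrib_left sum.distrib[symmetric]
    by (intro sum_mono pw)
  \<comment> \<open>Grouping the elements with \<open>d h\<close> at least 5 by their value makes
    this a partial sum of \<open>W\<close>, whose remaining terms are nonnegative.\<close>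
  have "3 * s_sum (\<lambda>i. {h. d h = i}) = (\<Sum>i\<in>d ` {h. 5 \<le> d h}. \<Sum>h | h \<in> {h. 5 \<le> d h} \<and> d h = i. w (d h))"
    unfolding s_sum_def sum_distrib_left
  proof (rule sum.cong)
    show "{i. 5 \<le> i \<and> {h. d h = i} \<noteq> {}} = d ` {h. 5 \<le> d h}" by auto
  next
    fix i assume "i \<in> d ` {h. 5 \<le> d h}"
    then have "5 \<le> i" and "{h. h \<in> {h. 5 \<le> d h} \<and> d h = i} = {h. d h = i}" by auto
    then show "3 * (s_wt i / 3 * real (card {h. d h = i})) = (\<Sum>h | h \<in> {h. 5 \<le> d h} \<and> d h = i. w (d h))"
      by (simp add: w5)
  qed
  also have "\<dots> = (\<Sum>h | 5 \<le> d h. w (d h))"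
    by (rule sum.image_gen[symmetric]) (rule finite_subset[OF subset_UNIV fin])
  also have "\<dots> \<le> W"
    unfolding W' by (rule sum_mono2) (use fin w_nonneg in auto)
  finally show "3 * s_sum (\<lambda>i. {h. d h = i}) \<le> W" .
qed

section \<open>Pairs with prescribed product and sum of squares\<close>

text \<open>Both roles of \<open>T0\<close> and \<open>T1\<close> are covered, hence only \<open>0 \<in> S \<union> R\<close> is assumed.\<close>

locale square_pair =
  fixes n :: nat and S R :: "'a :: ab_group_add set"
  assumes n_cong: "[n = 5] (mod 6)"
    and card_H: "card (UNIV :: 'a set) = n\<^sup>2 + n + 1"
    and inverse_closed: "inverse_closed S" "inverse_closed R"
    and zero_mem: "0 \<in> S \<union> R"
    and card_add: "card S + card R = 2 * n + 1"
    and mult_eq: "gr S * gr R = gr UNIV - 1"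
    and squares_eq: "(gr S)\<^sup>2 + (gr R)\<^sup>2
           = 2 * gr UNIV - (gr S)\<^bsup>(2)\<^esup> - (gr R)\<^bsup>(2)\<^esup> + of_nat (2 * n)"
begin

text \<open>The assumptions are symmetric, so every fact proved about \<open>S\<close> becomes
  available for \<open>R\<close>.\<close>

lemma swap: "square_pair n R S"
proof (rule square_pair.intro)
  show "gr R * gr S = gr UNIV - 1" using mult_eq by (simp only: mult.commute)
  show "(gr R)\<^sup>2 + (gr S)\<^sup>2
      = 2 * gr UNIV - (gr R)\<^bsup>(2)\<^esup> - (gr S)\<^bsup>(2)\<^esup> + of_nat (2 * n)"
    using squares_eq add.commute[of "(gr R)\<^sup>2" "(gr S)\<^sup>2"]
      cancel_ab_semigroup_add_class.diff_right_commute[of "2 * gr UNIV" "(gr R)\<^bsup>(2)\<^esup>" "(gr S)\<^bsup>(2)\<^esup>"] by (simp only:)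
  show "0 \<in> R \<union> S" using zero_mem by blast
  show "card R + card S = 2 * n + 1" using card_add by linarith
qed (rule n_cong card_H inverse_closed)+

lemma finite_H: "finite (UNIV :: 'a set)"
  by (rule card_ge_0_finite) (simp add: card_H)

lemma finite_set [simp]: "finite (D :: 'a set)"
  by (rule finite_subset[OF subset_UNIV finite_H])

lemma gr_mult_gr_UNIV: "gr D * gr UNIV = of_int (int (card D)) * gr (UNIV :: 'a set)"
  using mult_gr_UNIV[OF finite_H, of "gr D"] by (simp only: aug_gr[OF finite_H])

lemma obtain_n_eq: obtains m where "n = 6 * m + 5"
proof -
  have "n mod 6 = 5" using n_cong by (simp add: cong_def)
  then have "n = 6 * (n div 6) + 5" by presburger
  then show ?thesis by (rule that)
qed

text \<open>For n = 5 mod 6 the order of the group is 1 mod 6, hence prime to 2 and 3.\<close>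

lemma inj_zmul_2_3: "inj (zmul 2 :: 'a \<Rightarrow> 'a)" "inj (zmul 3 :: 'a \<Rightarrow> 'a)"
proof -
  obtain m where m: "n = 6 * m + 5" using obtain_n_eq .
  have "card (UNIV :: 'a set) = 2 * (18 * m\<^sup>2 + 33 * m + 15) + 1"
    unfolding card_H m by algebra
  from inj_zmul[OF finite_H this] show "inj (zmul 2 :: 'a \<Rightarrow> 'a)" by simp
  have "card (UNIV :: 'a set) = 3 * (12 * m\<^sup>2 + 22 * m + 10) + 1"
    unfolding card_H m by algebra
  from inj_zmul[OF finite_H this] show "inj (zmul 3 :: 'a \<Rightarrow> 'a)" by simp
qed

lemma zmul_2_2: "zmul 2 (zmul 2 g) = zmul 4 (g :: 'a)"
  by (simp add: zmul_simps add.assoc)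

lemma inj_zmul_4: "inj (zmul 4 :: 'a \<Rightarrow> 'a)"
  using inj_compose[OF inj_zmul_2_3(1) inj_zmul_2_3(1)] by (simp add: comp_def zmul_2_2)

lemma power_map_gr_2_3_4 [simp]:
  "(gr D)\<^bsup>(2)\<^esup> = gr (zmul 2 ` D :: 'a set)" "(gr D)\<^bsup>(3)\<^esup> = gr (zmul 3 ` D :: 'a set)"
  "(gr D)\<^bsup>(4)\<^esup> = gr (zmul 4 ` D :: 'a set)"
  using inj_zmul_2_3 inj_zmul_4
  by (auto intro!: power_map_gr[OF finite_H] intro: inj_on_subset)

lemma mem_image_2 [simp]: "zmul 2 x \<in> zmul 2 ` D \<longleftrightarrow> x \<in> (D :: 'a set)"
  using inj_zmul_2_3(1) by (auto simp: inj_def)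

lemmas gr_simps [simp] = gr_coeff_gr[OF finite_set] gr_supp_gr[OF finite_set]

lemma uminus_mem: "x \<in> S \<Longrightarrow> - x \<in> S"
proof -
  assume "x \<in> S"
  have "gr_coeff (gr S) (- x) = gr_coeff ((gr S)\<^bsup>(-1)\<^esup>) x"
    by (simp add: gr_coeff_power_map_uminus[OF finite_H] del: gr_simps)
  then show ?thesis using inverse_closed(1) \<open>x \<in> S\<close> by (simp add: inverse_closed_def split: if_splits)
qed

lemma uminus_mem_iff: "- x \<in> S \<longleftrightarrow> x \<in> S"
  using uminus_mem[of x] uminus_mem[of "- x"] by auto

text \<open>A common element \<open>x\<close> would give the product of \<open>x\<close> and its
  inverse as a representation of e in S R, where e has coefficient 0.\<close>

lemma disjoint: "S \<inter> R = {}"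
proof (rule ccontr)
  assume "S \<inter> R \<noteq> {}"
  then obtain x where x: "x \<in> S" "x \<in> R" by auto
  have "gr_coeff (gr S * gr R) (0 :: 'a) = 0"
    unfolding mult_eq by (simp add: lookup_minus lookup_one)
  then have "(\<Sum>g\<in>UNIV. of_bool (g \<in> S) * of_bool (0 - g \<in> R) :: int) = 0"
    by (simp only: gr_coeff_mult[OF finite_H] gr_simps)
  then have "\<forall>g\<in>UNIV. of_bool (g \<in> S) * of_bool (0 - g \<in> R) = (0 :: int)"
    by (subst (asm) sum_nonneg_eq_0_iff) auto
  then show False using x square_pair.uminus_mem[OF swap x(2)] by (auto dest: bspec[of _ _ x])
qed

lemma That_eq: "That S R = gr (S \<union> R)"
  by (simp add: That_def gr_Un disjoint)

section \<open>Coefficients of S^2\<close>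

lemma square_coeff_eq_card: "gr_coeff ((gr S)\<^sup>2) h = int (card {g \<in> S. h - g \<in> S})"
  by (simp add: power2_eq_square gr_coeff_mult[OF finite_H] flip: of_bool_conj)

lemma square_coeff_zero: "gr_coeff ((gr S)\<^sup>2) 0 = int (card S)"
proof -
  have "{g \<in> S. 0 - g \<in> S} = S" by (auto simp: uminus_mem_iff)
  then show ?thesis by (simp add: square_coeff_eq_card)
qed

lemma square_coeff_uminus: "gr_coeff ((gr S)\<^sup>2) (- h) = gr_coeff ((gr S)\<^sup>2) h"
proof -
  have "((gr S)\<^sup>2)\<^bsup>(-1)\<^esup> = (gr S)\<^sup>2"
    using inverse_closed(1) by (simp only: inverse_closed_def power2_eq_square power_map_mult[OF finite_H])
  then show ?thesis by (metis gr_coeff_power_map_uminus[OF finite_H])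
qed

lemma square_coeff_ge_2:
  assumes "p \<in> S" "q \<in> S" "p \<noteq> q" "h - p \<in> S" "h - q \<in> S"
  shows "2 \<le> gr_coeff ((gr S)\<^sup>2) h"
proof -
  have "card {p, q} \<le> card {g \<in> S. h - g \<in> S}"
    using assms by (intro card_mono) auto
  then show ?thesis using assms(3) by (simp add: square_coeff_eq_card)
qed

lemma square_coeff_parity: "\<exists>c. gr_coeff ((gr S)\<^sup>2) h = of_bool (h \<in> zmul 2 ` S) + 2 * c"
proof -
  have "\<exists>C. (A + B) ^ 2 = A ^ 2 + B ^ 2 + of_nat 2 * C" for A B :: "'a \<Rightarrow>\<^sub>0 int"
    by (rule exI[of _ "A * B"]) (simp add: power2_eq_square algebra_simps)
  then obtain C where "(gr S) ^ 2 = (gr S)\<^bsup>(int 2)\<^esup> + of_nat 2 * C"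
    using frobenius[OF finite_set finite_H, of 2 S] by auto
  then show ?thesis using gr_coeff_of_int_mult[of 2 C h]
    by (simp add: lookup_add)
qed

lemma cube_coeff_mod_3: "\<exists>c. gr_coeff ((gr S) ^ 3) h = of_bool (h \<in> zmul 3 ` S) + 3 * c"
proof -
  have "\<exists>C. (A + B) ^ 3 = A ^ 3 + B ^ 3 + of_nat 3 * C" for A B :: "'a \<Rightarrow>\<^sub>0 int"
    by (rule exI[of _ "A * A * B + A * B * B"]) (simp add: power3_eq_cube algebra_simps)
  then obtain C where "(gr S) ^ 3 = (gr S)\<^bsup>(int 3)\<^esup> + of_nat 3 * C"
    using frobenius[OF finite_set finite_H, of 3 S] by auto
  then show ?thesis using gr_coeff_of_int_mult[of 3 C h]
    by (simp add: lookup_add)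
qed

lemma square_coeff_add:
  assumes "h \<noteq> 0"
  shows "gr_coeff ((gr S)\<^sup>2) h + gr_coeff ((gr R)\<^sup>2) h
    = 2 - of_bool (h \<in> zmul 2 ` S) - of_bool (h \<in> zmul 2 ` R)"
  using arg_cong[OF squares_eq, of "\<lambda>A. gr_coeff A h"] assms
    gr_coeff_of_int_mult[of 2 "gr UNIV" h] gr_coeff_of_int_mult[of "2 * int n" 1 h]
  by (simp add: lookup_add lookup_minus lookup_one)

text \<open>By \<open>square_coeff_add\<close> the coefficient is at most 2, and at most 1 on S^(2).
  It is odd exactly on S^(2), so it is 1 there and 0 or 2 elsewhere.\<close>

lemma square_coeff:
  assumes "h \<noteq> 0"
  shows "gr_coeff ((gr S)\<^sup>2) h = of_bool (h \<in> zmul 2 ` S)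
    + 2 * of_bool (h \<in> gr_supp ((gr S)\<^sup>2) - zmul 2 ` S)"
proof -
  obtain c where c: "gr_coeff ((gr S)\<^sup>2) h = of_bool (h \<in> zmul 2 ` S) + 2 * c"
    using square_coeff_parity by blast
  have "0 \<le> gr_coeff ((gr S)\<^sup>2) h" "0 \<le> gr_coeff ((gr R)\<^sup>2) h"
    using square_coeff_eq_card square_pair.square_coeff_eq_card[OF swap] by simp_all
  moreover have "h \<notin> zmul 2 ` R" if "h \<in> zmul 2 ` S"
    using that disjoint mem_image_2 by blast
  ultimately show ?thesis
    using square_coeff_add[OF assms] c by (auto simp: in_keys_iff of_bool_def split: if_splits)
qed

text \<open>
  This is \<open>theta0\<close> or \<open>theta1\<close>: the first summand vanishes if \<open>0 \<in> S\<close>, and \<open>0\<close> already belongs to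
  \<open>zmul 2 ` S\<close> in that case.
\<close>

definition theta :: real where
  "theta = real (card (S \<inter> zmul 2 ` (S \<union> R) - {0})) / 2
    + real (card ((gr_supp ((gr S)\<^sup>2) - (zmul 2 ` S \<union> {0})) \<inter> zmul 4 ` (S \<union> R)))"

lemma sum_square_coeff:
  "real_of_int (\<Sum>h\<in>zmul 4 ` (S \<union> R). gr_coeff ((gr S)\<^sup>2) h) = card S + 2 * theta"
proof -
  let ?F = "zmul 4 ` (S \<union> R)"
  have "0 \<in> ?F" using zero_mem by (metis image_eqI zmul_zero)
  then have "(\<Sum>h\<in>?F. gr_coeff ((gr S)\<^sup>2) h)
      = int (card S) + (\<Sum>h\<in>?F - {0}. gr_coeff ((gr S)\<^sup>2) h)"
    by (simp add: sum.remove[of _ 0] square_coeff_zero)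
  also have "(\<Sum>h\<in>?F - {0}. gr_coeff ((gr S)\<^sup>2) h)
      = (\<Sum>h\<in>?F - {0}. of_bool (h \<in> zmul 2 ` S)
          + 2 * of_bool (h \<in> gr_supp ((gr S)\<^sup>2) - zmul 2 ` S))"
    by (rule sum.cong) (auto simp: square_coeff)
  also have "\<dots> = int (card ((?F - {0}) \<inter> zmul 2 ` S))
      + 2 * int (card ((?F - {0}) \<inter> (gr_supp ((gr S)\<^sup>2) - zmul 2 ` S)))"
    by (simp add: sum.distrib flip: sum_distrib_left del: Diff_iff)
  \<comment> \<open>T^(4) is the image of T^(2) under squaring, so the intersection with S^(2) is an
    image too. Its elements count once and the others twice, whence the factor 1/2 in
    \<open>theta\<close>.\<close>
  also have "(?F - {0}) \<inter> zmul 2 ` S = zmul 2 ` (S \<inter> zmul 2 ` (S \<union> R) - {0})"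
  proof -
    have "?F = zmul 2 ` zmul 2 ` (S \<union> R)" by (simp add: image_image zmul_2_2)
    then show ?thesis using inj_zmul_2_3(1)
      by (simp add: image_set_diff image_Int Int_commute Diff_Int_distrib) blast
  qed
  also have "card \<dots> = card (S \<inter> zmul 2 ` (S \<union> R) - {0})"
    by (rule card_image) (use inj_zmul_2_3(1) in \<open>auto intro: inj_on_subset\<close>)
  also have "(?F - {0}) \<inter> (gr_supp ((gr S)\<^sup>2) - zmul 2 ` S)
    = (gr_supp ((gr S)\<^sup>2) - (zmul 2 ` S \<union> {0})) \<inter> ?F" by auto
  finally show ?thesis by (simp add: theta_def)
qed

text \<open>This forbids two representations of such an element in S^2, the contradiction behind the
  next two lemmas.\<close>

lemma square_coeff_double_le_1:
  assumes "x \<in> S \<union> R" and "x \<noteq> 0"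
  shows "gr_coeff ((gr S)\<^sup>2) (zmul 2 x) \<le> 1"
proof -
  have "zmul 2 x \<noteq> 0" using assms(2) injD[OF inj_zmul_2_3(1), of x 0] by auto
  then have "gr_coeff ((gr S)\<^sup>2) (zmul 2 x) + gr_coeff ((gr R)\<^sup>2) (zmul 2 x)
      = 2 - of_bool (x \<in> S) - of_bool (x \<in> R)"
    using square_coeff_add[of "zmul 2 x"] by (simp only: mem_image_2 not_False_eq_True)
  moreover have "0 \<le> gr_coeff ((gr R)\<^sup>2) (zmul 2 x)"
    using square_pair.square_coeff_eq_card[OF swap] by simp
  ultimately show ?thesis using assms(1) by (auto simp: of_bool_def split: if_splits)
qed

text \<open>If the square of x lies in S and is not e, pairing it with e in either order gives two
  representations in S^2.\<close>

lemma Int_image_zmul_2: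
  assumes "0 \<in> S"
  shows "S \<inter> zmul 2 ` (S \<union> R) - {0} = {}"
proof (rule ccontr)
  assume "S \<inter> zmul 2 ` (S \<union> R) - {0} \<noteq> {}"
  then obtain x where x: "x \<in> S \<union> R" "zmul 2 x \<in> S" "zmul 2 x \<noteq> 0" by blast
  then have "2 \<le> gr_coeff ((gr S)\<^sup>2) (zmul 2 x)"
    using assms by (intro square_coeff_ge_2[of 0 "zmul 2 x"]) auto
  moreover have "x \<noteq> 0" using x(3) by auto
  ultimately show False using square_coeff_double_le_1[OF x(1)] by simp
qed

text \<open>If y and its cube lie in S, then y^2 is the product of y^3 and y^(-1) in either order;
  these representations differ unless y^4 = e, that is y = e.\<close>

lemma Int_image_zmul_3: "S \<inter> zmul 3 ` S \<subseteq> {0}"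
proof (rule subsetI, rule ccontr)
  fix x assume x: "x \<in> S \<inter> zmul 3 ` S" "x \<notin> {0}"
  then obtain y where y: "y \<in> S" "x = zmul 3 y" by blast
  then have "y \<noteq> 0" using x by auto
  then have "zmul 4 y \<noteq> 0" using injD[OF inj_zmul_4, of y 0] by auto
  then have "x \<noteq> - y" using y by (auto simp: zmul_simps eq_neg_iff_add_eq_0)
  moreover have "zmul 2 y - x = - y" "zmul 2 y - - y = x" by (simp_all add: y zmul_simps)
  ultimately have "2 \<le> gr_coeff ((gr S)\<^sup>2) (zmul 2 y)"
    using x y uminus_mem by (intro square_coeff_ge_2[of x "- y"]) auto
  then show False using square_coeff_double_le_1[of y] y \<open>y \<noteq> 0\<close> by simp
qed

lemma card_Int_image_zmul_3:
  assumes "0 \<in> S"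
  shows "card ((S \<union> R) \<inter> zmul 3 ` S) = 1 + card (R \<inter> zmul 3 ` S)"
proof -
  have "0 \<in> zmul 3 ` S" using assms by (metis image_eqI zmul_zero)
  then have "(S \<union> R) \<inter> zmul 3 ` S = insert 0 (R \<inter> zmul 3 ` S)"
    using Int_image_zmul_3 assms by blast
  moreover have "0 \<notin> R" using disjoint assms by blast
  ultimately show ?thesis by simp
qed

section \<open>Sizes of the two sets\<close>

lemma card_mult: "card S * card R = n\<^sup>2 + n"
proof -
  have "int (card S * card R) = aug (gr UNIV - 1 :: 'a \<Rightarrow>\<^sub>0 int)"
    unfolding mult_eq[symmetric] by (simp add: aug_mult[OF finite_H] aug_gr[OF finite_H])
  also have "\<dots> = int (n\<^sup>2 + n)"
    using finite_H by (simp add: aug_def lookup_minus lookup_one when_def sum_subtractf card_H)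
  finally show ?thesis by (simp only: of_nat_eq_iff)
qed

text \<open>Sum and product of the sizes leave only n and n + 1. Since e lies in S^(2), its
  coefficient |S| in S^2 is odd, and n is odd.\<close>

lemma card_eq:
  assumes "0 \<in> S"
  shows "card S = n" "card R = n + 1"
proof -
  obtain m where m: "n = 6 * m + 5" using obtain_n_eq .
  have "0 \<in> zmul 2 ` S" using assms by (metis image_eqI zmul_zero)
  then have "odd (card S)"
    using square_coeff_parity[of 0] by (auto simp: square_coeff_zero) presburger
  have "(int (card S) - int n) * (int (card S) - (int n + 1)) = 0"
  proof -
    have R: "int (card R) = 2 * int n + 1 - int (card S)" using card_add by linarith
    have "int (card S) * int (card R) = (int n)\<^sup>2 + int n"
      using arg_cong[OF card_mult, of int] by simp
    then show ?thesis unfolding R by (simp add: algebra_simps power2_eq_square)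
  qed
  then have "card S = n \<or> card S = n + 1" by auto
  with \<open>odd (card S)\<close> m show "card S = n" by auto
  with card_add show "card R = n + 1" by simp
qed

section \<open>The element T^(2) S: residues modulo 3 and first two moments\<close>

abbreviation D :: "'a \<Rightarrow>\<^sub>0 int" where
  "D \<equiv> (That S R)\<^bsup>(2)\<^esup> * gr S"

lemma D_eq: "D = of_int (2 * int (card S) - int (card R)) * gr UNIV
    + of_nat (2 * n) * gr S + gr R - (gr S) ^ 3"
proof -
  have S: "gr S * gr UNIV = of_int (int (card S)) * gr UNIV"
    and R: "gr R * gr UNIV = of_int (int (card R)) * gr UNIV"
    by (rule gr_mult_gr_UNIV)+
  show ?thesis
    unfolding That_def power_map_add[OF finite_H] of_int_diff of_int_mult of_int_numeral
    by (rule sum_mult_eq[OF mult_eq squares_eq S R])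
qed

text \<open>Natural-valued to fit \<open>level_set_bounds\<close>; \<open>nat\<close> loses nothing
  because the coefficients are nonnegative.\<close>

definition d :: "'a \<Rightarrow> nat" where
  "d h = nat (gr_coeff D h)"

lemma d_eq: "int (d h) = gr_coeff D h"
  unfolding d_def That_eq by (simp add: gr_coeff_mult[OF finite_H] sum_nonneg)

lemma d_mod_3: "\<exists>c. int (d h) = 1 - of_bool (h \<in> zmul 3 ` S) + of_bool (h \<in> S \<union> R) + 3 * c"
proof -
  obtain m where m: "n = 6 * m + 5" using obtain_n_eq .
  obtain c where c: "gr_coeff ((gr S) ^ 3) h = of_bool (h \<in> zmul 3 ` S) + 3 * c"
    using cube_coeff_mod_3 by blast
  have k: "int (card R) = 2 * int n + 1 - int (card S)" using card_add by linarith
  have "of_bool (h \<in> S \<union> R) = (of_bool (h \<in> S) + of_bool (h \<in> R) :: int)"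
    using disjoint by auto
  moreover have "gr_coeff (of_nat (2 * n) * gr S) h = 2 * int n * of_bool (h \<in> S)"
    using gr_coeff_of_int_mult[of "int (2 * n)" "gr S" h] by simp
  \<comment> \<open>Modulo 3, n = 2 gives 2n = 1 and 2|S| - |R| = 3|S| - (2n + 1) = 1, so T^(2) S
    becomes H + S + R - S^(3); the last factor collects the quotients.\<close>
  ultimately have "int (d h) = 1 - of_bool (h \<in> zmul 3 ` S) + of_bool (h \<in> S \<union> R)
      + 3 * (int (card S) - 4 * int m - 4 + (4 * int m + 3) * of_bool (h \<in> S) - c)"
    unfolding d_eq D_eq lookup_add lookup_minus gr_coeff_of_int_mult c k
    by (simp add: m algebra_simps)
  then show ?thesis by blast
qed

lemma d_level_sets:
  "{h. d h mod 3 = 0} = zmul 3 ` S - (S \<union> R)" "{h. d h mod 3 = 2} = (S \<union> R) - zmul 3 ` S"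
proof -
  \<comment> \<open>\<open>U\<close> and \<open>V\<close> stand for membership of \<open>h\<close>
    in S^(3) and in T.\<close>
  have *: "(m mod 3 = 0 \<longleftrightarrow> U \<and> \<not> V) \<and> (m mod 3 = 2 \<longleftrightarrow> V \<and> \<not> U)"
    if "int m = 1 - of_bool U + of_bool V + 3 * c" for m :: nat and U V and c :: int
    using that by (cases U; cases V; simp only: of_bool_eq simp_thms; presburger)
  have "(d h mod 3 = 0 \<longleftrightarrow> h \<in> zmul 3 ` S - (S \<union> R)) \<and> (d h mod 3 = 2 \<longleftrightarrow> h \<in> (S \<union> R) - zmul 3 ` S)" for h
  proof -
    obtain c where "int (d h) = 1 - of_bool (h \<in> zmul 3 ` S) + of_bool (h \<in> S \<union> R) + 3 * c"
      using d_mod_3[of h] by (rule exE)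
    then show ?thesis unfolding Diff_iff by (rule *)
  qed
  then show "{h. d h mod 3 = 0} = zmul 3 ` S - (S \<union> R)" "{h. d h mod 3 = 2} = (S \<union> R) - zmul 3 ` S"
    by (simp_all only: set_eq_iff mem_Collect_eq simp_thms)
qed

lemma card_level_sets:
  "real (card {h. d h mod 3 = 0}) = real (card S) - real (card ((S \<union> R) \<inter> zmul 3 ` S))"
  "real (card {h. d h mod 3 = 2}) = 2 * real n + 1 - real (card ((S \<union> R) \<inter> zmul 3 ` S))"
proof -
  have "card (zmul 3 ` S) = card S"
    by (rule card_image) (use inj_zmul_2_3(2) in \<open>auto intro: inj_on_subset\<close>)
  moreover have "card (S \<union> R) = 2 * n + 1"
    using card_add disjoint by (simp add: card_Un_disjoint)
  moreover have "real (card (C - E)) = real (card C) - real (card (C \<inter> E))" for C E :: "'a set"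
    by (simp add: card_Diff_subset_Int of_nat_diff card_mono)
  ultimately show "real (card {h. d h mod 3 = 0}) = real (card S) - real (card ((S \<union> R) \<inter> zmul 3 ` S))"
    "real (card {h. d h mod 3 = 2}) = 2 * real n + 1 - real (card ((S \<union> R) \<inter> zmul 3 ` S))"
    unfolding d_level_sets by (simp_all add: Int_commute)
qed

lemma sum_d: "(\<Sum>h\<in>UNIV. real (d h)) = (2 * real n + 1) * real (card S)"
proof -
  have "card (zmul 2 ` (S \<union> R)) = card (S \<union> R)"
    by (rule card_image) (use inj_zmul_2_3(1) in \<open>auto intro: inj_on_subset\<close>)
  also have "\<dots> = 2 * n + 1"
    using card_add disjoint by (simp add: card_Un_disjoint)
  finally have c: "card (zmul 2 ` (S \<union> R)) = 2 * n + 1" .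
  have "(\<Sum>h\<in>UNIV. real (d h)) = real_of_int (aug D)"
    by (simp add: aug_def flip: d_eq)
  also have "aug D = int (2 * n + 1) * int (card S)"
    unfolding That_eq power_map_gr_2_3_4 aug_mult[OF finite_H] aug_gr[OF finite_H] c ..
  finally show ?thesis by simp
qed

lemma That_2_square: "(That S R)\<^bsup>(2)\<^esup> * (That S R)\<^bsup>(2)\<^esup>
    = 4 * gr UNIV - (That S R)\<^bsup>(4)\<^esup> + of_int (2 * int n - 2)"
proof -
  have "That S R * That S R = of_int 4 * gr UNIV + - (That S R)\<^bsup>(2)\<^esup> + of_int (2 * int n - 2)"
    using add_square_eq[OF mult_eq squares_eq] unfolding That_def power_map_add[OF finite_H] by simp
  then have "(That S R)\<^bsup>(2)\<^esup> * (That S R)\<^bsup>(2)\<^esup>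
      = (of_int 4 * gr UNIV + - (That S R)\<^bsup>(2)\<^esup> + of_int (2 * int n - 2))\<^bsup>(2)\<^esup>"
    by (simp only: flip: power_map_mult[OF finite_H])
  also have "\<dots> = of_int 4 * (gr UNIV)\<^bsup>(2)\<^esup> - (That S R)\<^bsup>(4)\<^esup> + of_int (2 * int n - 2)"
    by (simp only: power_map_add[OF finite_H] power_map_mult[OF finite_H] power_map_of_int
        power_map_uminus[OF finite_H] power_map_power_map[OF finite_H zmul_2_2]) simp
  also have "(gr UNIV)\<^bsup>(2)\<^esup> = (gr UNIV :: 'a \<Rightarrow>\<^sub>0 int)"
    using finite_UNIV_inj_surj[OF finite_H inj_zmul_2_3(1)] by simp
  finally show ?thesis by simp
qed

text \<open>Inverse symmetry is what makes the sum of squared coefficients the coefficient of e in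
  \<open>D * D\<close>.\<close>

lemma D_uminus: "D\<^bsup>(-1)\<^esup> = D"
proof -
  have "(A\<^bsup>(2)\<^esup>)\<^bsup>(-1)\<^esup> = (A\<^bsup>(-1)\<^esup>)\<^bsup>(2)\<^esup>" for A :: "'a \<Rightarrow>\<^sub>0 int"
    using power_map_power_map[OF finite_H, of "-1" 2 "-2" A]
      power_map_power_map[OF finite_H, of 2 "-1" "-2" A] by (simp add: zmul_simps)
  then show ?thesis
    using inverse_closed unfolding inverse_closed_def
    by (simp only: power_map_mult[OF finite_H] That_def power_map_add[OF finite_H])
qed

lemma sum_d_square:
  "(\<Sum>h\<in>UNIV. (real (d h))\<^sup>2)
    = 4 * (real (card S))\<^sup>2 + (2 * real n - 3) * real (card S) - 2 * theta"
proof -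
  have S: "gr S * gr UNIV = of_int (int (card S)) * gr UNIV"
    by (rule gr_mult_gr_UNIV)
  have "(\<Sum>h\<in>UNIV. (int (d h))\<^sup>2) = (\<Sum>h\<in>UNIV. gr_coeff D h * gr_coeff D (0 - h))"
    using D_uminus gr_coeff_power_map_uminus[OF finite_H, of D]
    by (simp add: d_eq power2_eq_square)
  also have "\<dots> = gr_coeff (D * D) 0"
    by (simp add: gr_coeff_mult[OF finite_H, of D D])
  also have "D * D = gr S * gr S * ((That S R)\<^bsup>(2)\<^esup> * (That S R)\<^bsup>(2)\<^esup>)"
    by (simp only: mult_ac)
  also have "\<dots> = 4 * (gr S * (gr S * gr UNIV)) - (That S R)\<^bsup>(4)\<^esup> * (gr S)\<^sup>2
      + of_int (2 * int n - 2) * (gr S)\<^sup>2"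
    unfolding That_2_square by (simp add: algebra_simps power2_eq_square)
  also have "4 * (gr S * (gr S * gr UNIV)) = of_int (4 * (int (card S) * int (card S))) * gr UNIV"
    unfolding S mult.left_commute[of "gr S"] by (simp add: mult.assoc)
  also have "gr_coeff (of_int (4 * (int (card S) * int (card S))) * gr UNIV
      - (That S R)\<^bsup>(4)\<^esup> * (gr S)\<^sup>2 + of_int (2 * int n - 2) * (gr S)\<^sup>2) 0
    = 4 * (int (card S))\<^sup>2 - gr_coeff ((That S R)\<^bsup>(4)\<^esup> * (gr S)\<^sup>2) 0
      + (2 * int n - 2) * int (card S)"
    unfolding lookup_add lookup_minus gr_coeff_of_int_mult square_coeff_zero
    by (simp add: power2_eq_square)
  \<comment> \<open>Since T^(4) has coefficients 0 and 1 and S^2 is symmetric under inversion, this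
    coefficient is the sum evaluated in \<open>sum_square_coeff\<close>.\<close>
  also have "gr_coeff ((That S R)\<^bsup>(4)\<^esup> * (gr S)\<^sup>2) 0
      = (\<Sum>h\<in>zmul 4 ` (S \<union> R). gr_coeff ((gr S)\<^sup>2) h)"
    by (simp add: gr_coeff_mult[OF finite_H] That_eq square_coeff_uminus sum.If_cases
        if_distrib of_bool_def if_distribR cong: if_cong)
  finally have "real_of_int (\<Sum>h\<in>UNIV. (int (d h))\<^sup>2) =
      4 * (real (card S))\<^sup>2 - (real (card S) + 2 * theta) + (2 * real n - 2) * real (card S)"
    by (simp only: of_int_add of_int_diff of_int_mult sum_square_coeff) simp
  then show ?thesis by (simp add: algebra_simps)
qed

text \<open>The parameters \<open>k\<close> and \<open>q\<close> are tied to the sets by equations,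
  so that they can be instantiated with expressions such as \<open>N + 1\<close> and
  \<open>1 + l0\<close>.\<close>

lemma coefficient_bounds:
  fixes W B P k q :: real
  assumes Z: "Z = (\<lambda>i. {h. gr_coeff D h = int i})"
    and k: "k = card S" and q: "q = card ((S \<union> R) \<inter> zmul 3 ` S)"
    and W: "W = 2 * k\<^sup>2 - (4 * real n + 3) * k + 2 * (real n)\<^sup>2 + 4 * n + 3 - 2 * q - theta"
    and B: "B = (2 * real n - 1) * k - (real n)\<^sup>2 - 3 * n - 2 + 3 * q"
    and P: "P = (real n)\<^sup>2 - n - k + 2 * q"
  shows "3 * real (card (Z 0)) \<le> W" "3 * s_sum Z \<le> W"
    "3 * P - B - 2 * W \<le> 3 * real (card (Z 1))" "3 * real (card (Z 1)) \<le> 3 * P - B + 2 * W"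
    "B - 2 * W \<le> 3 * real (card (Z 4))" "3 * real (card (Z 4)) \<le> B + W"
proof -
  have Z': "Z = (\<lambda>i. {h. d h = i})"
    unfolding Z by (simp flip: d_eq)
  have V: "real (card (UNIV :: 'a set)) = (real n)\<^sup>2 + n + 1" by (simp add: card_H)
  \<comment> \<open>The quadratic weight is a combination of the two moments of \<open>d\<close> and
    the group order.\<close>
  have "(\<Sum>h\<in>UNIV. (real (d h) - 1) * (real (d h) - 4) / 2)
      = ((\<Sum>h\<in>UNIV. (real (d h))\<^sup>2) - 5 * (\<Sum>h\<in>UNIV. real (d h)) + 4 * real (card (UNIV :: 'a set))) / 2"
    by (simp add: sum_divide_distrib[symmetric] sum.distrib[symmetric] sum_subtractf[symmetric] sum_distrib_left
        power2_eq_square algebra_simps flip: sum_constant)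
  then have W': "W = (\<Sum>h\<in>UNIV. (real (d h) - 1) * (real (d h) - 4) / 2)
               + real (card {h. d h mod 3 = 0}) + real (card {h. d h mod 3 = 2})"
    unfolding sum_d sum_d_square card_level_sets V W k q by (simp add: field_simps power2_eq_square)
  have B': "B = (\<Sum>h\<in>UNIV. real (d h)) - real (card (UNIV :: 'a set))
               - 2 * real (card {h. d h mod 3 = 0}) - real (card {h. d h mod 3 = 2})"
    unfolding sum_d card_level_sets V B k q by (simp add: algebra_simps)
  have P': "P = real (card (UNIV :: 'a set)) - real (card {h. d h mod 3 = 0}) - real (card {h. d h mod 3 = 2})"
    unfolding card_level_sets V P k q by (simp add: algebra_simps)
  show "3 * real (card (Z 0)) \<le> W" "3 * s_sum Z \<le> W"
    "3 * P - B - 2 * W \<le> 3 * real (card (Z 1))" "3 * real (card (Z 1)) \<le> 3 * P - B + 2 * W"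
    "B - 2 * W \<le> 3 * real (card (Z 4))" "3 * real (card (Z 4)) \<le> B + W"
    unfolding Z' using level_set_bounds[OF finite_H W' B' P'] by blast+
qed

end

section \<open>Specialisation to both orders of the pair\<close>

theorem theorem4p3:
  fixes n :: nat and T0 T1 :: "'a::ab_group_add set"
    and N l0 u t0 t1 :: real and x y :: "nat \<Rightarrow> real"
  assumes "[n = 5] (mod 6)"
    and "card (UNIV :: 'a set) = n\<^sup>2 + n + 1"
    and "inverse_closed T0" and "inverse_closed T1"
    and "0 \<in> T0"
    and "card T0 + card T1 = 2 * n + 1"
    and "gr T0 * gr T1 = gr UNIV - 1"
    and "(gr T0)\<^sup>2 + (gr T1)\<^sup>2
           = 2 * gr UNIV - (gr T0)\<^bsup>(2)\<^esup> - (gr T1)\<^bsup>(2)\<^esup> + of_nat (2 * n)"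
    and "N = real n"
    and "l0 = real (card (T1 \<inter> gr_supp ((gr T0)\<^bsup>(3)\<^esup>)))"
    and "u = real (card (T0 \<inter> gr_supp ((gr T1)\<^bsup>(3)\<^esup>))) + real (card (T1 \<inter> gr_supp ((gr T1)\<^bsup>(3)\<^esup>)))"
    and "t0 = theta0 T0 T1" and "t1 = theta1 T0 T1"
    and "\<And>i. x i = real (card (X_set T0 T1 i))" and "\<And>i. y i = real (card (Y_set T0 T1 i))"
  shows "x 0 \<le> (N - 2 * l0 + 1 - t0) / 3
    \<and> s_sum (X_set T0 T1) \<le> (N - 2 * l0 + 1 - t0) / 3
    \<and> (2 * N\<^sup>2 - 4 * N + 7 * l0 + 3 + 2 * t0) / 3 \<le> x 1
    \<and> x 1 \<le> (2 * N\<^sup>2 - l0 + 7 - 2 * t0) / 3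
    \<and> (N\<^sup>2 - 6 * N + 7 * l0 - 1 + 2 * t0) / 3 \<le> x 4
    \<and> x 4 \<le> (N\<^sup>2 - 3 * N + l0 + 2 - t0) / 3
    \<and> y 0 \<le> (N - 2 * u + 2 - t1) / 3
    \<and> s_sum (Y_set T0 T1) \<le> (N - 2 * u + 2 - t1) / 3
    \<and> (2 * N\<^sup>2 - 6 * N + 7 * u - 4 + 2 * t1) / 3 \<le> y 1
    \<and> y 1 \<le> (2 * N\<^sup>2 - 2 * N - u + 4 - 2 * t1) / 3
    \<and> (N\<^sup>2 - 4 * N + 7 * u - 7 + 2 * t1) / 3 \<le> y 4
    \<and> y 4 \<le> (N\<^sup>2 - N + u - 1 - t1) / 3"
proof -
  interpret P: square_pair n T0 T1
    using assms(1-8) by (intro square_pair.intro) auto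
  interpret Q: square_pair n T1 T0 by (rule P.swap)
  have That: "gr_supp ((That T0 T1)\<^bsup>(2)\<^esup>) = zmul 2 ` (T0 \<union> T1)"
    "gr_supp ((That T0 T1)\<^bsup>(4)\<^esup>) = zmul 4 ` (T0 \<union> T1)"
    unfolding P.That_eq by simp_all
  have "0 \<in> zmul 2 ` T0" using assms(5) by (metis image_eqI zmul_zero)
  then have "zmul 2 ` T0 \<union> {0} = zmul 2 ` T0" by blast
  then have t0: "t0 = P.theta"
    unfolding assms(12) theta0_def P.theta_def That P.Int_image_zmul_2[OF assms(5)] by simp
  \<comment> \<open>Removing 0 changes nothing, because 0 lies in \<open>T0\<close> and hence not in
    \<open>T1\<close>.\<close>
  have "T1 \<inter> zmul 2 ` (T0 \<union> T1) = T1 \<inter> zmul 2 ` (T1 \<union> T0) - {0}"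
    using P.disjoint assms(5) by blast
  then have t1: "t1 = Q.theta"
    unfolding assms(13) theta1_def Q.theta_def That by (simp add: Un_commute)
  have l0: "1 + l0 = real (card ((T0 \<union> T1) \<inter> zmul 3 ` T0))"
    unfolding assms(10) by (simp add: P.card_Int_image_zmul_3[OF assms(5)])
  have "card ((T1 \<union> T0) \<inter> zmul 3 ` T1) = card (T0 \<inter> zmul 3 ` T1) + card (T1 \<inter> zmul 3 ` T1)"
    unfolding Int_Un_distrib2 using P.disjoint by (subst card_Un_disjoint) auto
  then have u: "u = real (card ((T1 \<union> T0) \<inter> zmul 3 ` T1))"
    unfolding assms(11) by simp
  have X: "X_set T0 T1 = (\<lambda>i. {h. gr_coeff P.D h = int i})"
    by (simp add: fun_eq_iff X_set_def)
  have Y: "Y_set T0 T1 = (\<lambda>i. {h. gr_coeff Q.D h = int i})"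
    by (simp add: fun_eq_iff Y_set_def That_def add.commute)
  have k: "N = real (card T0)" "N + 1 = real (card T1)"
    using P.card_eq[OF assms(5)] assms(9) by simp_all
  \<comment> \<open>With k = n and q = 1 + l0 the controlled sum is n - 2 l0 + 1 - t0; with k = n +
    1 and q = u it is n - 2u + 2 - t1.\<close>
  note bounds = P.coefficient_bounds[OF X k(1) l0 refl refl refl, folded t0]
    Q.coefficient_bounds[OF Y k(2) u refl refl refl, folded t1]
  show ?thesis
    unfolding assms(14,15) by (intro conjI; (insert bounds, simp add: assms(9) field_simps power2_eq_square))
qed

end
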